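(* Let $k$ be a field, $R = k[[X]]$, and $M$ a free $R$-module of rank $h$. Let $0 = M_0 \subseteq M_1 \subseteq \dots \subseteq M_l = M$ be direct summands with $M_i$ free of rank $h_i$ ($h_0 = 0$). Let $\overline{M_i} := M_i \otimes_R k$, let $\overline{L}$ be a $k$-subspace of $\overline{M}$, and $d_i := \dim_k(\overline{L} \cap \overline{M_i})$ (so $0 \leq d_{i+1} - d_i \leq h_{i+1} - h_i$). Let $d_0' = 0, d_1', \dots, d_l'$ be integers with $d_l' = d_l$, $0 \leq d_{i+1}' - d_i' \leq h_{i+1} - h_i$ for $0 \le i \le l-1$, and $d_i' \leq d_i$ for $1 \leq i \leq l-1$. Then there exists a direct summand $L \subseteq M$ with $L \otimes_R k = \overline{L}$ (as subspaces of $\overline{M}$) such that $\dim_{k((X))}\big((L \otimes_R k((X))) \cap (M_i \otimes_R k((X)))\big) = d_i'$ for all $1 \leq i \leq l$. *)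

theory Defs
  imports "HOL-Analysis.Analysis" "HOL-Computational_Algebra.Formal_Laurent_Series"
begin

text \<open>The free module M of rank h over R = k[[X]] is modelled as R^'n with CARD('n) = h.\<close>

definition scaleR_fps :: "'a::field fps \<Rightarrow> 'a fps ^ 'n \<Rightarrow> 'a fps ^ 'n" where
  "scaleR_fps c v = (\<chi> i. c * vec_nth v i)"

definition scale_k :: "'a::field \<Rightarrow> 'a ^ 'n \<Rightarrow> 'a ^ 'n" where
  "scale_k c v = (\<chi> i. c * vec_nth v i)"

definition scale_K :: "'a::field fls \<Rightarrow> 'a fls ^ 'n \<Rightarrow> 'a fls ^ 'n" where
  "scale_K c v = (\<chi> i. c * vec_nth v i)"

text \<open>R-submodules, direct summands, free of given rank.\<close>
definition submoduleR :: "('a::field fps ^ 'n) set \<Rightarrow> bool" where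
  "submoduleR S = module.subspace scaleR_fps S"

definition direct_summand :: "('a::field fps ^ 'n) set \<Rightarrow> bool" where
  "direct_summand L \<longleftrightarrow> submoduleR L \<and>
     (\<exists>N. submoduleR N \<and> L \<inter> N = {0} \<and> {x + y | x y. x \<in> L \<and> y \<in> N} = UNIV)"

definition free_of_rank :: "('a::field fps ^ 'n) set \<Rightarrow> nat \<Rightarrow> bool" where
  "free_of_rank S r \<longleftrightarrow> (\<exists>B. finite B \<and> card B = r \<and>
     \<not> module.dependent scaleR_fps B \<and> module.span scaleR_fps B = S)"

text \<open>Reduction mod X: for a direct summand S, S \<otimes>_R k is the image of S in k^'n.\<close>
definition red :: "'a::field fps ^ 'n \<Rightarrow> 'a ^ 'n" where
  "red v = (\<chi> i. fps_nth (vec_nth v i) 0)"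

text \<open>Base change to K = k((X)): S \<otimes>_R K is the K-span of S inside K^'n.\<close>
definition ext :: "'a::field fps ^ 'n \<Rightarrow> 'a fls ^ 'n" where
  "ext v = (\<chi> i. fps_to_fls (vec_nth v i))"

definition tensor_K :: "('a::field fps ^ 'n) set \<Rightarrow> ('a fls ^ 'n) set" where
  "tensor_K S = module.span scale_K (ext ` S)"

definition subspace_k :: "('a::field ^ 'n) set \<Rightarrow> bool" where
  "subspace_k S = module.subspace scale_k S"

definition dim_k :: "('a::field ^ 'n) set \<Rightarrow> nat" where
  "dim_k S = vector_space.dim scale_k S"

definition dim_K :: "('a::field fls ^ 'n) set \<Rightarrow> nat" where
  "dim_K S = vector_space.dim scale_K S"

end

theory Submission
  imports Defs
begin

text \<open>Choose a basis b of Lbar adapted to the flag Lbar \<inter> (M_i \<otimes> k), so that b_j first lies in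
  level a(j), and let lam(j) be the level at which the j-th basis vector has to appear in order to
  produce the dimensions d'_i; since d'_i \<le> d_i we have a(j) \<le> lam(j). At level m the vectors
  with lam(j) = m have to be independent modulo M_(m-1) \<otimes> k. Those with a(j) = m already are, and
  the bound d'_m - d'_(m-1) \<le> h_m - h_(m-1) leaves room to complete them by residues rho_j in
  M_m \<otimes> k that are independent modulo M_(m-1) \<otimes> k. Lift b_j to g_j in M_a(j) and put
  v_j = g_j + X w_j, where w_j in M_lam(j) lifts rho_j (and w_j = 0 if a(j) = lam(j)). The span L of
  the v_j reduces to Lbar and is a direct summand by Nakayama's lemma; the v_j with lam(j) = m are
  independent modulo M_(m-1) over k[[X]] and hence over k((X)), so that
  dim (L \<otimes> k((X)) \<inter> M_i \<otimes> k((X))) = #{j. lam(j) \<le> i} = d'_i.\<close>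

interpretation Rmod: module "(*s) :: 'a::comm_ring_1 \<Rightarrow> 'a^'n \<Rightarrow> 'a^'n"
  by unfold_locales (vector algebra_simps)+

lemma scaleR_fps_eq: "scaleR_fps = (*s)"
  by (auto simp: scaleR_fps_def vector_scalar_mult_def fun_eq_iff)

lemma scale_k_eq: "scale_k = (*s)"
  by (auto simp: scale_k_def vector_scalar_mult_def fun_eq_iff)

lemma scale_K_eq: "scale_K = (*s)"
  by (auto simp: scale_K_def vector_scalar_mult_def fun_eq_iff)

section \<open>Independence modulo a subspace\<close>

definition indep_mod :: "('r::zero \<Rightarrow> 'v \<Rightarrow> 'v::comm_monoid_add) \<Rightarrow> 'v set \<Rightarrow> 'c set \<Rightarrow> ('c \<Rightarrow> 'v) \<Rightarrow> bool"
  where "indep_mod s U J u \<longleftrightarrow> (\<forall>c. (\<Sum>j\<in>J. s (c j) (u j)) \<in> U \<longrightarrow> (\<forall>j\<in>J. c j = 0))"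

context module
begin

lemma span_image_family:
  assumes "finite J"
  shows "span (u ` J) = {\<Sum>j\<in>J. scale (c j) (u j) | c. True}"
  using assms
proof (induction J rule: finite_induct)
  case (insert a J)
  show ?case
  proof (intro set_eqI iffI)
    fix x assume "x \<in> span (u ` insert a J)"
    then obtain k where "x - scale k (u a) \<in> span (u ` J)"
      by (auto simp: span_insert)
    then obtain c where c: "x - scale k (u a) = (\<Sum>j\<in>J. scale (c j) (u j))"
      using insert.IH by auto
    have "(\<Sum>j\<in>insert a J. scale ((c(a:=k)) j) (u j)) = scale k (u a) + (\<Sum>j\<in>J. scale (c j) (u j))"
      using insert.hyps by simp (intro sum.cong, auto)
    also have "\<dots> = x"
      using c by (simp add: algebra_simps)
    finally show "x \<in> {\<Sum>j\<in>insert a J. scale (c j) (u j) | c. True}"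
      by (auto intro!: exI[of _ "c(a:=k)"])
  next
    fix x assume "x \<in> {\<Sum>j\<in>insert a J. scale (c j) (u j) | c. True}"
    then obtain c where x: "x = (\<Sum>j\<in>insert a J. scale (c j) (u j))" by auto
    have "\<And>j. j \<in> insert a J \<Longrightarrow> scale (c j) (u j) \<in> span (u ` insert a J)"
      by (intro span_scale span_base) auto
    then show "x \<in> span (u ` insert a J)"
      unfolding x by (rule span_sum)
  qed
qed simp

lemma in_span_image_familyE:
  assumes "finite J" "x \<in> span (u ` J)"
  obtains c where "x = (\<Sum>j\<in>J. scale (c j) (u j))"
  using span_image_family[OF assms(1), of u] assms(2) by auto

lemma indep_modD:
  "indep_mod scale U J u \<Longrightarrow> (\<Sum>j\<in>J. scale (c j) (u j)) \<in> U \<Longrightarrow> j \<in> J \<Longrightarrow> c j = 0"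
  unfolding indep_mod_def by blast

lemma indep_mod_cong:
  "(\<And>j. j \<in> J \<Longrightarrow> u j = v j) \<Longrightarrow> indep_mod scale U J u \<longleftrightarrow> indep_mod scale U J v"
  unfolding indep_mod_def by (simp cong: sum.cong)

lemma indep_mod_subset:
  assumes "indep_mod scale U J u" "J' \<subseteq> J" "finite J"
  shows "indep_mod scale U J' u"
  unfolding indep_mod_def
proof (intro allI impI ballI)
  fix c j assume sum: "(\<Sum>j\<in>J'. scale (c j) (u j)) \<in> U" and j: "j \<in> J'"
  let ?c = "\<lambda>j. if j \<in> J' then c j else 0"
  have "(\<Sum>j\<in>J. scale (?c j) (u j)) = (\<Sum>j\<in>J'. scale (c j) (u j))"
    using assms(2,3) by (auto intro: sum.mono_neutral_cong_right)
  then have "?c j = 0"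
    using assms(1,2) j sum by (intro indep_modD[of U J u ?c]) auto
  with j show "c j = 0" by simp
qed

lemma indep_mod_zero_inj_on:
  assumes "indep_mod scale {0} J u" "finite J"
  shows "inj_on u J"
proof (rule inj_onI, rule ccontr)
  fix a b assume ab: "a \<in> J" "b \<in> J" "u a = u b" "a \<noteq> b"
  let ?c = "\<lambda>j. if j = a then 1 else if j = b then -1 else 0"
  have "(\<Sum>j\<in>J. scale (?c j) (u j)) = (\<Sum>j\<in>J. (if j = a then u a else 0) + (if j = b then - u b else 0))"
    using ab by (intro sum.cong) auto
  also have "\<dots> = 0"
    using ab assms(2) by (simp add: sum.distrib)
  finally have "(\<Sum>j\<in>J. scale (?c j) (u j)) \<in> {0}" by simp
  from indep_modD[OF assms(1) this ab(1)] show False by simp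
qed

lemma indep_mod_zero_independent:
  assumes "indep_mod scale {0} J u" "finite J"
  shows "independent (u ` J)"
proof
  assume "dependent (u ` J)"
  then obtain w where w: "\<exists>v\<in>u ` J. w v \<noteq> 0" "(\<Sum>v\<in>u ` J. scale (w v) v) = 0"
    using dependent_finite[of "u ` J"] assms(2) by auto
  have "(\<Sum>j\<in>J. scale (w (u j)) (u j)) = 0"
    using w(2) sum.reindex[OF indep_mod_zero_inj_on[OF assms], of "\<lambda>v. scale (w v) v"] by simp
  then have "\<forall>j\<in>J. w (u j) = 0"
    using assms(1) unfolding indep_mod_def by auto
  with w(1) show False by auto
qed

lemma indep_mod_zeroI:
  assumes "inj_on u J" "independent (u ` J)" "finite J"
  shows "indep_mod scale {0} J u"
  unfolding indep_mod_def
proof (intro allI impI ballI)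
  fix c j assume sum: "(\<Sum>j\<in>J. scale (c j) (u j)) \<in> {0}" and j: "j \<in> J"
  let ?w = "\<lambda>v. c (the_inv_into J u v)"
  have "(\<Sum>v\<in>u ` J. scale (?w v) v) = (\<Sum>j\<in>J. scale (c j) (u j))"
    using assms(1) by (simp add: sum.reindex the_inv_into_f_f)
  with sum have "(\<Sum>v\<in>u ` J. scale (?w v) v) = 0" by simp
  then have "?w (u j) = 0"
    using assms(2,3) j dependent_finite[of "u ` J"] by auto
  then show "c j = 0"
    using assms(1) j by (simp add: the_inv_into_f_f)
qed

lemma span_inter_span_indep_mod_zero:
  assumes "indep_mod scale {0} (A \<union> B) u" "A \<inter> B = {}" "finite A" "finite B"
  shows "span (u ` A) \<inter> span (u ` B) = {0}"
proof (intro set_eqI iffI)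
  fix x assume x: "x \<in> span (u ` A) \<inter> span (u ` B)"
  obtain a where a: "x = (\<Sum>j\<in>A. scale (a j) (u j))"
    using x in_span_image_familyE[OF assms(3)] by blast
  obtain b where b: "x = (\<Sum>j\<in>B. scale (b j) (u j))"
    using x in_span_image_familyE[OF assms(4)] by blast
  define c where "c j = (if j \<in> A then a j else - b j)" for j
  have "(\<Sum>j\<in>A \<union> B. scale (c j) (u j)) = (\<Sum>j\<in>A. scale (c j) (u j)) + (\<Sum>j\<in>B. scale (c j) (u j))"
    by (rule sum.union_disjoint[OF assms(3,4,2)])
  also have "(\<Sum>j\<in>A. scale (c j) (u j)) = x"
    unfolding a c_def by (intro sum.cong) auto
  also have "(\<Sum>j\<in>B. scale (c j) (u j)) = - x"
    using assms(2) unfolding b c_def sum_negf[symmetric]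
    by (intro sum.cong) auto
  finally have "(\<Sum>j\<in>A \<union> B. scale (c j) (u j)) \<in> {0}" by simp
  then have "c j = 0" if "j \<in> A" for j
    using indep_modD[OF assms(1)] that by blast
  then have "\<forall>j\<in>A. a j = 0"
    by (simp add: c_def)
  then show "x \<in> {0}"
    unfolding a by simp
qed (auto intro: span_zero)

end

section \<open>Flags and adapted bases\<close>

lemma lift_Suc_mono_le_bounded:
  fixes f :: "nat \<Rightarrow> 'a::order"
  assumes "\<And>i. i < l \<Longrightarrow> f i \<le> f (Suc i)" "i \<le> i'" "i' \<le> l"
  shows "f i \<le> f i'"
  by (rule lift_Suc_mono_le_ivl[of "{..<l}" f]) (use assms in auto)

context vector_space
begin

lemma flag_coeff_eq_0:
  assumes sub: "\<And>i. i \<le> l \<Longrightarrow> subspace (F i)"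
    and mono: "\<And>i. i < l \<Longrightarrow> F i \<subseteq> F (Suc i)"
    and lev: "\<And>j. j \<in> J \<Longrightarrow> lam j \<le> l \<and> u j \<in> F (lam j)"
    and ind: "\<And>m. 1 \<le> m \<Longrightarrow> m \<le> l \<Longrightarrow> indep_mod scale (F (m - 1)) {j\<in>J. lam j = m} u"
    and fin: "finite J"
    and sum: "(\<Sum>j\<in>J. scale (c j) (u j)) \<in> F i" and i: "i \<le> l"
  shows "\<forall>j\<in>J. i < lam j \<longrightarrow> c j = 0"
proof -
  note Fmono = lift_Suc_mono_le_bounded[of l F, OF mono]
  have "\<forall>j\<in>J. l - k < lam j \<longrightarrow> c j = 0" if "k \<le> l - i" for k
    using that
  proof (induction k)
    case 0
    then show ?case using lev by fastforce
  next
    case (Suc k)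
    define m where "m = l - k"
    have m: "1 \<le> m" "m \<le> l" "i < m" "l - Suc k = m - 1"
      using Suc.prems unfolding m_def by auto
    have IH: "\<forall>j\<in>J. m < lam j \<longrightarrow> c j = 0"
      using Suc unfolding m_def by auto
    let ?f = "\<lambda>j. scale (c j) (u j)"
    let ?A = "{j\<in>J. lam j < m}" and ?B = "{j\<in>J. lam j = m}"
    have "(\<Sum>j\<in>J. ?f j) = (\<Sum>j\<in>?A \<union> ?B. ?f j)"
      using IH fin by (intro sum.mono_neutral_right) auto
    also have "\<dots> = sum ?f ?A + sum ?f ?B"
      using fin by (intro sum.union_disjoint) auto
    finally have "sum ?f ?B = (\<Sum>j\<in>J. ?f j) - sum ?f ?A"
      by (simp add: algebra_simps)
    moreover have "F i \<subseteq> F (m - 1)"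
      using m by (intro Fmono) auto
    then have "(\<Sum>j\<in>J. ?f j) \<in> F (m - 1)"
      using sum by auto
    moreover have "sum ?f ?A \<in> F (m - 1)"
    proof (rule subspace_sum)
      fix j assume j: "j \<in> ?A"
      have "F (lam j) \<subseteq> F (m - 1)"
        using j lev m by (intro Fmono) auto
      then have "u j \<in> F (m - 1)"
        using j lev by auto
      then show "?f j \<in> F (m - 1)"
        using sub m by (intro subspace_scale) auto
    qed (use sub m in auto)
    ultimately have "sum ?f ?B \<in> F (m - 1)"
      using sub m by (auto intro: subspace_diff)
    then have "\<forall>j\<in>?B. c j = 0"
      using ind[OF m(1,2)] unfolding indep_mod_def by blast
    then show ?case
      using IH m(4) by auto
  qed
  from this[of "l - i"] i show ?thesis by auto
qed

lemma dim_span_inter_flag: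
  assumes sub: "\<And>i. i \<le> l \<Longrightarrow> subspace (F i)"
    and mono: "\<And>i. i < l \<Longrightarrow> F i \<subseteq> F (Suc i)"
    and lev: "\<And>j. j \<in> J \<Longrightarrow> 1 \<le> lam j \<and> lam j \<le> l \<and> u j \<in> F (lam j)"
    and ind: "\<And>m. 1 \<le> m \<Longrightarrow> m \<le> l \<Longrightarrow> indep_mod scale (F (m - 1)) {j\<in>J. lam j = m} u"
    and fin: "finite J" and i: "i \<le> l"
  shows "dim (span (u ` J) \<inter> F i) = card {j\<in>J. lam j \<le> i}"
proof -
  have lev': "\<And>j. j \<in> J \<Longrightarrow> lam j \<le> l \<and> u j \<in> F (lam j)"
    using lev by auto
  note vanish = flag_coeff_eq_0[OF sub mono lev' ind fin]
  define S where "S = {j\<in>J. lam j \<le> i}"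
  have fS: "finite S"
    using fin unfolding S_def by auto
  have "span (u ` J) \<inter> F i \<subseteq> span (u ` S)"
  proof
    fix x assume x: "x \<in> span (u ` J) \<inter> F i"
    then obtain c where xc: "x = (\<Sum>j\<in>J. scale (c j) (u j))"
      using in_span_image_familyE[OF fin] by blast
    have "\<forall>j\<in>J. i < lam j \<longrightarrow> c j = 0"
      using vanish[where i=i and c=c] lev x xc i by auto
    then have "x = (\<Sum>j\<in>S. scale (c j) (u j))"
      unfolding xc S_def using fin by (intro sum.mono_neutral_right) (auto simp: not_le)
    then show "x \<in> span (u ` S)"
      using span_image_family[OF fS, of u] by auto
  qed
  moreover have "span (u ` S) \<subseteq> F i"
    using lev lift_Suc_mono_le_bounded[of l F, OF mono] sub i
    by (intro span_minimal) (force simp: S_def)+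
  moreover have "span (u ` S) \<subseteq> span (u ` J)"
    by (rule span_mono) (auto simp: S_def)
  ultimately have eq: "span (u ` J) \<inter> F i = span (u ` S)"
    by blast
  have "indep_mod scale {0} J u"
    unfolding indep_mod_def
  proof (intro allI impI ballI)
    fix c j assume "(\<Sum>j\<in>J. scale (c j) (u j)) \<in> {0}" "j \<in> J"
    then show "c j = 0"
      using vanish[where i=0 and c=c] lev sub[of 0] subspace_0 by fastforce
  qed
  then have indS: "indep_mod scale {0} S u"
    by (rule indep_mod_subset) (auto simp: S_def fin)
  have "dim (span (u ` S)) = card (u ` S)"
    using indep_mod_zero_independent[OF indS fS] by (rule dim_span_eq_card_independent)
  also have "\<dots> = card S"
    using indep_mod_zero_inj_on[OF indS fS] by (rule card_image)
  finally show ?thesis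
    using eq S_def by simp
qed

lemma indep_mod_adapted_block:
  fixes b :: "nat \<Rightarrow> 'b"
  assumes ind: "indep_mod scale {0} {..<d} b" and U: "subspace U" and L: "subspace L"
    and sp: "span (b ` {..<D1}) = L \<inter> U" and D: "D1 \<le> D2" "D2 \<le> d"
    and inL: "b ` {..<D2} \<subseteq> L"
  shows "indep_mod scale U {D1..<D2} b"
  unfolding indep_mod_def
proof (intro allI impI ballI)
  fix \<gamma> j assume sum: "(\<Sum>j\<in>{D1..<D2}. scale (\<gamma> j) (b j)) \<in> U" and j: "j \<in> {D1..<D2}"
  have "(\<Sum>j\<in>{D1..<D2}. scale (\<gamma> j) (b j)) \<in> L"
    using inL by (intro subspace_sum[OF L] subspace_scale[OF L]) auto
  with sum have "(\<Sum>j\<in>{D1..<D2}. scale (\<gamma> j) (b j)) \<in> span (b ` {..<D1})"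
    using sp by blast
  then obtain c where c: "(\<Sum>j\<in>{D1..<D2}. scale (\<gamma> j) (b j)) = (\<Sum>j<D1. scale (c j) (b j))"
    using span_image_family[OF finite_lessThan, of b] by auto
  define \<delta> where "\<delta> j = (if j < D1 then - c j else if j < D2 then \<gamma> j else 0)" for j
  have "(\<Sum>j<d. scale (\<delta> j) (b j)) = (\<Sum>j\<in>{..<D1} \<union> {D1..<D2}. scale (\<delta> j) (b j))"
    using D by (intro sum.mono_neutral_right) (auto simp: \<delta>_def)
  also have "\<dots> = (\<Sum>j<D1. scale (\<delta> j) (b j)) + (\<Sum>j\<in>{D1..<D2}. scale (\<delta> j) (b j))"
    by (rule sum.union_disjoint) auto
  also have "(\<Sum>j<D1. scale (\<delta> j) (b j)) = - (\<Sum>j<D1. scale (c j) (b j))"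
    by (simp add: \<delta>_def sum_negf)
  also have "(\<Sum>j\<in>{D1..<D2}. scale (\<delta> j) (b j)) = (\<Sum>j\<in>{D1..<D2}. scale (\<gamma> j) (b j))"
    by (intro sum.cong) (auto simp: \<delta>_def)
  finally have "(\<Sum>j<d. scale (\<delta> j) (b j)) \<in> {0}"
    using c by simp
  then have "\<delta> j = 0"
    using indep_modD[OF ind] j D by auto
  then show "\<gamma> j = 0"
    using j by (simp add: \<delta>_def)
qed

end

context finite_dimensional_vector_space
begin

lemma indep_mod_insert:
  assumes U: "subspace U" and W: "subspace W" and fJ: "finite J" and a: "a \<notin> J"
    and ind: "indep_mod scale U J \<rho>" and \<rho>W: "\<rho> ` J \<subseteq> W"
    and card: "card J + dim U < dim W"
  shows "\<exists>w\<in>W. indep_mod scale U (insert a J) (\<rho>(a := w))"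
proof -
  obtain E where E: "E \<subseteq> U" "independent E" "U \<subseteq> span E" "card E = dim U"
    using basis_exists[of U] by blast
  have fE: "finite E"
    using E(2) finiteI_independent by blast
  let ?T = "\<rho> ` J"
  have "span (U \<union> ?T) \<subseteq> span (E \<union> ?T)"
    using E(3) span_mono[of E "E \<union> ?T"] span_superset[of "E \<union> ?T"]
    by (intro span_minimal) auto
  then have "dim (span (U \<union> ?T)) \<le> card (E \<union> ?T)"
    using fE fJ by (intro dim_le_card) auto
  also have "\<dots> \<le> card E + card ?T"
    by (rule card_Un_le)
  also have "card ?T \<le> card J"
    using fJ by (rule card_image_le)
  finally have "dim (span (U \<union> ?T)) < dim W"
    using card E(4) by simp
  then have "\<not> W \<subseteq> span (U \<union> ?T)"
    using dim_subset[of W "span (U \<union> ?T)"] by auto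
  then obtain w where w: "w \<in> W" "w \<notin> span (U \<union> ?T)"
    by auto
  have "indep_mod scale U (insert a J) (\<rho>(a := w))"
    unfolding indep_mod_def
  proof (intro allI impI)
    fix c assume sum: "(\<Sum>j\<in>insert a J. scale (c j) ((\<rho>(a := w)) j)) \<in> U"
    have "(\<Sum>j\<in>J. scale (c j) ((\<rho>(a := w)) j)) = (\<Sum>j\<in>J. scale (c j) (\<rho> j))"
      using a by (intro sum.cong) auto
    with sum have eq: "scale (c a) w + (\<Sum>j\<in>J. scale (c j) (\<rho> j)) \<in> U"
      using a fJ by simp
    have rest: "(\<Sum>j\<in>J. scale (c j) (\<rho> j)) \<in> span (U \<union> ?T)"
      by (intro span_sum span_scale span_base) auto
    have "c a = 0"
    proof (rule ccontr)
      assume ca: "c a \<noteq> 0"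
      have "scale (c a) w + (\<Sum>j\<in>J. scale (c j) (\<rho> j)) \<in> span (U \<union> ?T)"
        using eq span_superset by blast
      then have "scale (c a) w \<in> span (U \<union> ?T)"
        using rest span_diff by fastforce
      then have "w \<in> span (U \<union> ?T)"
        using ca span_scale[of _ _ "inverse (c a)"] by fastforce
      with w(2) show False ..
    qed
    with eq have "(\<Sum>j\<in>J. scale (c j) (\<rho> j)) \<in> U"
      by simp
    then have "\<forall>j\<in>J. c j = 0"
      using ind unfolding indep_mod_def by blast
    with \<open>c a = 0\<close> show "\<forall>j\<in>insert a J. c j = 0"
      by auto
  qed
  with w(1) show ?thesis ..
qed

lemma indep_mod_extend:
  assumes U: "subspace U" and W: "subspace W" and fA: "finite A" and fJ: "finite J"
    and disj: "A \<inter> J = {}" and ind: "indep_mod scale U J \<rho>" and \<rho>W: "\<rho> ` J \<subseteq> W"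
    and card: "card J + card A + dim U \<le> dim W"
  shows "\<exists>\<rho>'. (\<forall>j\<in>J. \<rho>' j = \<rho> j) \<and> \<rho>' ` (J \<union> A) \<subseteq> W \<and> indep_mod scale U (J \<union> A) \<rho>'"
  using fA disj card
proof (induction A rule: finite_induct)
  case empty
  then show ?case using ind \<rho>W by auto
next
  case (insert a A)
  then obtain \<rho>1 where \<rho>1: "\<forall>j\<in>J. \<rho>1 j = \<rho> j" "\<rho>1 ` (J \<union> A) \<subseteq> W" "indep_mod scale U (J \<union> A) \<rho>1"
    by auto
  have a: "a \<notin> J \<union> A"
    using insert by auto
  have "card (J \<union> A) + dim U < dim W"
    using insert card_Un_le[of J A] by simp
  then obtain w where w: "w \<in> W" "indep_mod scale U (insert a (J \<union> A)) (\<rho>1(a := w))"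
    using indep_mod_insert[OF U W _ a \<rho>1(3) \<rho>1(2)] fJ insert.hyps(1) by blast
  have "\<forall>j\<in>J. (\<rho>1(a := w)) j = \<rho> j"
    using \<rho>1(1) a by auto
  moreover have "(\<rho>1(a := w)) ` (J \<union> insert a A) \<subseteq> W"
    using \<rho>1(2) w(1) a by auto
  moreover have "indep_mod scale U (J \<union> insert a A) (\<rho>1(a := w))"
    using w(2) by (simp add: Un_insert_right)
  ultimately show ?case
    by blast
qed

lemma indep_mod_extend_subset:
  assumes U: "subspace U" and W: "subspace W" and fJ: "finite J" and NJ: "N \<subseteq> J"
    and ind: "indep_mod scale U N \<rho>" and \<rho>W: "\<rho> ` N \<subseteq> W" and card: "card J + dim U \<le> dim W"
  shows "\<exists>\<rho>'. (\<forall>j\<in>N. \<rho>' j = \<rho> j) \<and> \<rho>' ` J \<subseteq> W \<and> indep_mod scale U J \<rho>'"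
proof -
  have "card N + card (J - N) + dim U \<le> dim W"
    using card card_Diff_subset[OF finite_subset[OF NJ fJ] NJ] card_mono[OF fJ NJ] by linarith
  moreover have "finite (J - N)" "finite N" "(J - N) \<inter> N = {}"
    using fJ NJ finite_subset by auto
  ultimately have "\<exists>\<rho>'. (\<forall>j\<in>N. \<rho>' j = \<rho> j) \<and> \<rho>' ` (N \<union> (J - N)) \<subseteq> W \<and>
      indep_mod scale U (N \<union> (J - N)) \<rho>'"
    using U W ind \<rho>W by (intro indep_mod_extend) simp_all
  moreover have "N \<union> (J - N) = J"
    using NJ by auto
  ultimately show ?thesis
    by simp
qed

lemma extend_indep_family:
  fixes b :: "nat \<Rightarrow> 'b"
  assumes ind: "indep_mod scale {0} {..<n} b" and T: "subspace T" and bT: "b ` {..<n} \<subseteq> T"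
  shows "\<exists>b'. (\<forall>j<n. b' j = b j) \<and> indep_mod scale {0} {..<dim T} b' \<and> span (b' ` {..<dim T}) = T"
proof -
  define S where "S = b ` {..<n}"
  obtain B where B: "S \<subseteq> B" "B \<subseteq> T" "independent B" "T \<subseteq> span B"
    using maximal_independent_subset_extend[OF bT[folded S_def]]
      indep_mod_zero_independent[OF ind] S_def by blast
  have fB: "finite B"
    using B(3) finiteI_independent by blast
  have spB: "span B = T"
    using B(2,4) span_minimal[OF B(2) T] by auto
  have cB: "card B = dim T"
    by (rule basis_card_eq_dim[OF B(2,4,3)])
  have cS: "card S = n"
    unfolding S_def using card_image[OF indep_mod_zero_inj_on[OF ind]] by simp
  have nT: "n \<le> dim T"
    using card_mono[OF fB B(1)] cS cB by simp
  have "card (B - S) = dim T - n"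
    using card_Diff_subset[OF finite_subset[OF B(1) fB] B(1)] cB cS by simp
  then obtain g where g: "bij_betw g {n..<dim T} (B - S)"
    using finite_same_card_bij[of "{n..<dim T}" "B - S"] fB by auto
  define b' where "b' j = (if j < n then b j else g j)" for j
  have "{..<dim T} = {..<n} \<union> {n..<dim T}"
    using nT by auto
  then have "b' ` {..<dim T} = b' ` {..<n} \<union> b' ` {n..<dim T}"
    by (simp add: image_Un)
  also have "b' ` {..<n} = S"
    unfolding S_def b'_def by auto
  also have "b' ` {n..<dim T} = g ` {n..<dim T}"
    unfolding b'_def by auto
  also have "\<dots> = B - S"
    using g by (simp add: bij_betw_def)
  finally have img: "b' ` {..<dim T} = B"
    using B(1) by auto
  have "inj_on b' {..<dim T}"
    by (rule eq_card_imp_inj_on) (use img cB in auto)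
  then have "indep_mod scale {0} {..<dim T} b'"
    by (rule indep_mod_zeroI) (use img B(3) in auto)
  moreover have "\<forall>j<n. b' j = b j"
    by (simp add: b'_def)
  ultimately show ?thesis
    using img spB by blast
qed

lemma exists_flag_adapted_basis:
  fixes V :: "nat \<Rightarrow> 'b set"
  assumes sub: "\<And>i. i \<le> l \<Longrightarrow> subspace (V i)" and mono: "\<And>i. i < l \<Longrightarrow> V i \<subseteq> V (Suc i)"
  obtains b where "indep_mod scale {0} {..<dim (V l)} b"
    and "\<And>i. i \<le> l \<Longrightarrow> span (b ` {..<dim (V i)}) = V i"
proof -
  have dim_mono: "dim (V i') \<le> dim (V i)" if "i' \<le> i" "i \<le> l" for i i'
    using lift_Suc_mono_le_bounded[of l V, OF mono that] by (rule dim_subset)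
  have "\<exists>b. indep_mod scale {0} {..<dim (V i)} b \<and> (\<forall>i'\<le>i. span (b ` {..<dim (V i')}) = V i')"
    if "i \<le> l" for i
    using that
  proof (induction i)
    case 0
    have "indep_mod scale {0} {..<0::nat} (\<lambda>_. 0)"
      by (simp add: indep_mod_def)
    then have "\<exists>b. (\<forall>j<0. b j = 0) \<and> indep_mod scale {0} {..<dim (V 0)} b \<and>
        span (b ` {..<dim (V 0)}) = V 0"
      by (rule extend_indep_family) (simp_all add: sub)
    then obtain b where "indep_mod scale {0} {..<dim (V 0)} b" "span (b ` {..<dim (V 0)}) = V 0"
      by blast
    then show ?case
      by (intro exI[of _ b]) simp
  next
    case (Suc i)
    then have "i \<le> l"
      by simp
    with Suc.IH obtain b where b: "indep_mod scale {0} {..<dim (V i)} b"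
      "\<forall>i'\<le>i. span (b ` {..<dim (V i')}) = V i'"
      by blast
    have "span (b ` {..<dim (V i)}) = V i"
      using b(2) by simp
    then have "b ` {..<dim (V i)} \<subseteq> V i"
      using span_superset[of "b ` {..<dim (V i)}"] by simp
    also have "V i \<subseteq> V (Suc i)"
      using mono[of i] Suc.prems by simp
    finally have "b ` {..<dim (V i)} \<subseteq> V (Suc i)" .
    then obtain b' where b': "\<forall>j<dim (V i). b' j = b j"
      "indep_mod scale {0} {..<dim (V (Suc i))} b'" "span (b' ` {..<dim (V (Suc i))}) = V (Suc i)"
      using extend_indep_family[OF b(1) sub[OF Suc.prems]] by blast
    have "span (b' ` {..<dim (V i')}) = V i'" if "i' \<le> Suc i" for i'
    proof (cases "i' = Suc i")
      case False
      then have "i' \<le> i"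
        using that by simp
      then have "b' ` {..<dim (V i')} = b ` {..<dim (V i')}"
        using b'(1) dim_mono[of i' i] Suc.prems by (intro image_cong) auto
      then show ?thesis
        using b(2) \<open>i' \<le> i\<close> by simp
    qed (use b'(3) in simp)
    with b'(2) show ?case
      by blast
  qed
  then obtain b where "indep_mod scale {0} {..<dim (V l)} b" "\<forall>i\<le>l. span (b ` {..<dim (V i)}) = V i"
    by blast
  then show ?thesis
    using that by blast
qed

lemma exists_residue_family:
  fixes W :: "nat \<Rightarrow> 'b set" and b :: "nat \<Rightarrow> 'b" and lam a :: "nat \<Rightarrow> nat"
  assumes sub: "\<And>i. i \<le> l \<Longrightarrow> subspace (W i)"
    and lam: "\<And>j. j < d \<Longrightarrow> 1 \<le> lam j \<and> lam j \<le> l"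
    and card: "\<And>m. 1 \<le> m \<Longrightarrow> m \<le> l \<Longrightarrow> card {j. j < d \<and> lam j = m} + dim (W (m - 1)) \<le> dim (W m)"
    and nat_ind: "\<And>m. 1 \<le> m \<Longrightarrow> m \<le> l \<Longrightarrow>
      indep_mod scale (W (m - 1)) {j. j < d \<and> lam j = m \<and> a j = m} b"
    and nat_in: "\<And>j. j < d \<Longrightarrow> a j = lam j \<Longrightarrow> b j \<in> W (lam j)"
  shows "\<exists>\<rho>. (\<forall>j<d. \<rho> j \<in> W (lam j) \<and> (a j = lam j \<longrightarrow> \<rho> j = b j)) \<and>
    (\<forall>m. 1 \<le> m \<and> m \<le> l \<longrightarrow> indep_mod scale (W (m - 1)) {j. j < d \<and> lam j = m} \<rho>)"
proof -
  let ?J = "\<lambda>m. {j. j < d \<and> lam j = m}" and ?N = "\<lambda>m. {j. j < d \<and> lam j = m \<and> a j = m}"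
  have "\<exists>\<rho>. (\<forall>j\<in>?N m. \<rho> j = b j) \<and> \<rho> ` ?J m \<subseteq> W m \<and> indep_mod scale (W (m - 1)) (?J m) \<rho>"
    if m: "1 \<le> m" "m \<le> l" for m
  proof (rule indep_mod_extend_subset)
    show "subspace (W (m - 1))" "subspace (W m)"
      using sub m by auto
    show "b ` ?N m \<subseteq> W m"
      using nat_in by auto
  qed (use card[OF m] nat_ind[OF m] in auto)
  then have "\<forall>m. \<exists>\<rho>. 1 \<le> m \<and> m \<le> l \<longrightarrow>
      (\<forall>j\<in>?N m. \<rho> j = b j) \<and> \<rho> ` ?J m \<subseteq> W m \<and> indep_mod scale (W (m - 1)) (?J m) \<rho>"
    by blast
  then have "\<exists>R. \<forall>m. 1 \<le> m \<and> m \<le> l \<longrightarrow>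
      (\<forall>j\<in>?N m. R m j = b j) \<and> R m ` ?J m \<subseteq> W m \<and> indep_mod scale (W (m - 1)) (?J m) (R m)"
    by (rule choice)
  then obtain R where R: "\<And>m. 1 \<le> m \<Longrightarrow> m \<le> l \<Longrightarrow>
      (\<forall>j\<in>?N m. R m j = b j) \<and> R m ` ?J m \<subseteq> W m \<and> indep_mod scale (W (m - 1)) (?J m) (R m)"
    by blast
  define \<rho> where "\<rho> j = R (lam j) j" for j
  have "\<rho> j \<in> W (lam j) \<and> (a j = lam j \<longrightarrow> \<rho> j = b j)" if "j < d" for j
    using R[of "lam j"] lam[OF that] that by (auto simp: \<rho>_def)
  moreover have "indep_mod scale (W (m - 1)) (?J m) \<rho>" if "1 \<le> m" "m \<le> l" for m
    using R[OF that] indep_mod_cong[of "?J m" \<rho> "R m"] by (auto simp: \<rho>_def)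
  ultimately show ?thesis
    by blast
qed

end

section \<open>Levels\<close>

text \<open>If e i is the dimension of the i-th member of a flag and b a basis adapted to the flag,
  then b_j first appears at level first_level e j.\<close>

definition first_level :: "(nat \<Rightarrow> nat) \<Rightarrow> nat \<Rightarrow> nat"
  where "first_level e j = (LEAST i. j < e i)"

lemma less_first_level:
  "j < e l \<Longrightarrow> j < e (first_level e j)"
  unfolding first_level_def by (rule LeastI)

lemma first_level_le:
  "j < e l \<Longrightarrow> first_level e j \<le> l"
  unfolding first_level_def by (rule Least_le)

lemma first_level_bounds:
  "e 0 = 0 \<Longrightarrow> j < e l \<Longrightarrow> 1 \<le> first_level e j \<and> first_level e j \<le> l"
  using less_first_level[of j e l] first_level_le[of j e l] by (cases "first_level e j") auto

lemma first_level_le_iff: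
  assumes mono: "\<And>i. i < l \<Longrightarrow> e i \<le> e (Suc i)" and j: "j < e l" and i: "i \<le> l"
  shows "first_level e j \<le> i \<longleftrightarrow> j < e i"
proof
  assume "first_level e j \<le> i"
  then show "j < e i"
    using lift_Suc_mono_le_bounded[of l e, OF mono _ i] less_first_level[of j e l, OF j] by fastforce
next
  assume "j < e i"
  then show "first_level e j \<le> i"
    unfolding first_level_def by (rule Least_le)
qed

lemma first_level_antimono:
  assumes "j < e l" "e (first_level e j) \<le> D (first_level e j)"
  shows "first_level D j \<le> first_level e j"
  using less_first_level[of j e l, OF assms(1)] assms(2) unfolding first_level_def[of D]
  by (intro Least_le) simp

lemma first_level_eq_iff:
  assumes mono: "\<And>i. i < l \<Longrightarrow> e i \<le> e (Suc i)" and j: "j < e l" and m: "1 \<le> m" "m \<le> l"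
  shows "first_level e j = m \<longleftrightarrow> j \<in> {e (m - 1)..<e m}"
proof -
  have "first_level e j = m \<longleftrightarrow> first_level e j \<le> m \<and> \<not> first_level e j \<le> m - 1"
    using m by auto
  also have "\<dots> \<longleftrightarrow> j < e m \<and> \<not> j < e (m - 1)"
    using first_level_le_iff[of l e j, OF mono j] m by simp
  finally show ?thesis
    by auto
qed

lemma card_first_level_le:
  assumes mono: "\<And>i. i < l \<Longrightarrow> e i \<le> e (Suc i)" and i: "i \<le> l"
  shows "card {j. j < e l \<and> first_level e j \<le> i} = e i"
proof -
  have "e i \<le> e l"
    using lift_Suc_mono_le_bounded[of l e, OF mono i] by simp
  then have "{j. j < e l \<and> first_level e j \<le> i} = {..<e i}"
    using first_level_le_iff[of l e _ i, OF mono _ i] by auto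
  then show ?thesis by simp
qed

lemma card_first_level_eq:
  assumes mono: "\<And>i. i < l \<Longrightarrow> e i \<le> e (Suc i)" and m: "1 \<le> m" "m \<le> l"
  shows "card {j. j < e l \<and> first_level e j = m} = e m - e (m - 1)"
proof -
  have "e m \<le> e l"
    using lift_Suc_mono_le_bounded[of l e, OF mono m(2)] by simp
  have "j < e l \<and> first_level e j = m \<longleftrightarrow> j \<in> {e (m - 1)..<e m}" for j
  proof (cases "j < e l")
    case True
    then show ?thesis
      using first_level_eq_iff[of l e j m, OF mono True m] by simp
  next
    case False
    then show ?thesis
      using \<open>e m \<le> e l\<close> by auto
  qed
  then have "{j. j < e l \<and> first_level e j = m} = {e (m - 1)..<e m}"
    by blast
  then show ?thesis by simp
qed

lemma card_first_level_eq_le: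
  assumes mono: "\<And>i. i < l \<Longrightarrow> e i \<le> e (Suc i)"
    and step: "\<And>i. i < l \<Longrightarrow> e (Suc i) + H i \<le> H (Suc i) + e i" and m: "1 \<le> m" "m \<le> l"
  shows "card {j. j < e l \<and> first_level e j = m} + H (m - 1) \<le> H m"
proof -
  have "m - 1 < l" "Suc (m - 1) = m"
    using m by auto
  then have "e (m - 1) \<le> e m" "e m + H (m - 1) \<le> H m + e (m - 1)"
    using mono[of "m - 1"] step[of "m - 1"] by auto
  then show ?thesis
    using card_first_level_eq[of l e, OF mono m] by linarith
qed

context finite_dimensional_vector_space
begin

lemma adapted_basis_indep_mod_level:
  fixes b :: "nat \<Rightarrow> 'b" and W :: "nat \<Rightarrow> 'b set"
  assumes sub: "\<And>i. i \<le> l \<Longrightarrow> subspace (W i)" and mono: "\<And>i. i < l \<Longrightarrow> W i \<subseteq> W (Suc i)"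
    and L: "subspace L"
    and ind: "indep_mod scale {0} {..<dim (L \<inter> W l)} b"
    and span: "\<And>i. i \<le> l \<Longrightarrow> span (b ` {..<dim (L \<inter> W i)}) = L \<inter> W i"
    and m: "1 \<le> m" "m \<le> l"
  shows "indep_mod scale (W (m - 1)) {j. j < dim (L \<inter> W l) \<and> first_level (\<lambda>i. dim (L \<inter> W i)) j = m} b"
proof -
  let ?D = "\<lambda>i. dim (L \<inter> W i)"
  have D_mono: "?D i \<le> ?D (Suc i)" if "i < l" for i
    using mono[OF that] by (intro dim_subset) auto
  have D: "?D (m - 1) \<le> ?D m" "?D m \<le> ?D l"
    using lift_Suc_mono_le_bounded[of l ?D "m - 1" m, OF D_mono]
      lift_Suc_mono_le_bounded[of l ?D m l, OF D_mono] m by simp_all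
  have "b ` {..<?D m} \<subseteq> span (b ` {..<?D m})"
    by (rule span_superset)
  then have bL: "b ` {..<?D m} \<subseteq> L"
    using span[OF m(2)] by simp
  have "indep_mod scale (W (m - 1)) {?D (m - 1)..<?D m} b"
    using sub[of "m - 1"] span[of "m - 1"] m by (intro indep_mod_adapted_block[OF ind _ L _ D bL]) simp_all
  moreover have "{j. j < ?D l \<and> first_level ?D j = m} \<subseteq> {?D (m - 1)..<?D m}"
  proof
    fix j assume "j \<in> {j. j < ?D l \<and> first_level ?D j = m}"
    then show "j \<in> {?D (m - 1)..<?D m}"
      using first_level_eq_iff[of l ?D j m, OF D_mono _ m] by simp
  qed
  ultimately show ?thesis
    by (rule indep_mod_subset) simp
qed

lemma exists_adapted_basis_and_residues:
  fixes W :: "nat \<Rightarrow> 'b set" and e :: "nat \<Rightarrow> nat"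
  assumes sub: "\<And>i. i \<le> l \<Longrightarrow> subspace (W i)" and mono: "\<And>i. i < l \<Longrightarrow> W i \<subseteq> W (Suc i)"
    and L: "subspace L" "L \<subseteq> W l"
    and e0: "e 0 = 0" and el: "e l = dim L"
    and e_mono: "\<And>i. i < l \<Longrightarrow> e i \<le> e (Suc i)"
    and e_step: "\<And>i. i < l \<Longrightarrow> e (Suc i) + dim (W i) \<le> dim (W (Suc i)) + e i"
    and e_le: "\<And>i. i \<le> l \<Longrightarrow> e i \<le> dim (L \<inter> W i)"
  obtains b a \<rho> where "indep_mod scale {0} {..<e l} b" "span (b ` {..<e l}) = L"
    and "\<And>j. j < e l \<Longrightarrow> a j \<le> first_level e j \<and> b j \<in> W (a j)"
    and "\<And>j. j < e l \<Longrightarrow> \<rho> j \<in> W (first_level e j) \<and> (a j = first_level e j \<longrightarrow> \<rho> j = b j)"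
    and "\<And>m. 1 \<le> m \<Longrightarrow> m \<le> l \<Longrightarrow> indep_mod scale (W (m - 1)) {j. j < e l \<and> first_level e j = m} \<rho>"
proof -
  define D where "D i = dim (L \<inter> W i)" for i
  have Dl: "D l = e l"
    using L(2) el by (simp add: D_def Int_absorb2)
  have D_mono: "D i \<le> D (Suc i)" if "i < l" for i
    unfolding D_def using mono[OF that] by (intro dim_subset) auto
  have "subspace (L \<inter> W i)" if "i \<le> l" for i
    using L(1) sub[OF that] by (rule subspace_inter)
  moreover have "L \<inter> W i \<subseteq> L \<inter> W (Suc i)" if "i < l" for i
    using mono[OF that] by auto
  ultimately obtain b where b: "indep_mod scale {0} {..<D l} b"
    "\<And>i. i \<le> l \<Longrightarrow> span (b ` {..<D i}) = L \<inter> W i"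
    using exists_flag_adapted_basis[of l "\<lambda>i. L \<inter> W i"] unfolding D_def by blast
  let ?lam = "first_level e" and ?a = "first_level D"
  note lam = first_level_bounds[of e, OF e0]
  have a: "?a j \<le> ?lam j \<and> b j \<in> W (?a j)" if j: "j < e l" for j
  proof
    show "?a j \<le> ?lam j"
      using e_le lam[OF j] unfolding D_def[symmetric] by (intro first_level_antimono[of j e l, OF j]) auto
    have "j < D (?a j)" "?a j \<le> l"
      using less_first_level[of j D l] first_level_le[of j D l] j Dl by auto
    then show "b j \<in> W (?a j)"
      using b(2)[of "?a j"] span_base[of "b j" "b ` {..<D (?a j)}"] by auto
  qed
  note card = card_first_level_eq_le[of l e, OF e_mono e_step]
  have nat_ind: "indep_mod scale (W (m - 1)) {j. j < e l \<and> ?lam j = m \<and> ?a j = m} b"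
    if m: "1 \<le> m" "m \<le> l" for m
    using adapted_basis_indep_mod_level[OF sub mono L(1) b[unfolded D_def] m]
    by (rule indep_mod_subset) (auto simp: D_def[symmetric] Dl)
  have "\<exists>\<rho>. (\<forall>j<e l. \<rho> j \<in> W (?lam j) \<and> (?a j = ?lam j \<longrightarrow> \<rho> j = b j)) \<and>
      (\<forall>m. 1 \<le> m \<and> m \<le> l \<longrightarrow> indep_mod scale (W (m - 1)) {j. j < e l \<and> ?lam j = m} \<rho>)"
  proof (rule exists_residue_family[where W = W and d = "e l" and lam = ?lam and b = b and a = ?a])
    show "b j \<in> W (?lam j)" if "j < e l" "?a j = ?lam j" for j
      using a[OF that(1)] that(2) by simp
  qed (use sub lam card nat_ind in auto)
  then obtain \<rho> where \<rho>: "\<forall>j<e l. \<rho> j \<in> W (?lam j) \<and> (?a j = ?lam j \<longrightarrow> \<rho> j = b j)"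
    "\<forall>m. 1 \<le> m \<and> m \<le> l \<longrightarrow> indep_mod scale (W (m - 1)) {j. j < e l \<and> ?lam j = m} \<rho>"
    by blast
  show ?thesis
  proof (rule that[of b ?a \<rho>])
    show "indep_mod scale {0} {..<e l} b"
      using b(1) Dl by simp
    show "span (b ` {..<e l}) = L"
      using b(2)[of l] Dl L(2) by auto
    show "?a j \<le> ?lam j \<and> b j \<in> W (?a j)" if "j < e l" for j
      using a[OF that] .
    show "\<rho> j \<in> W (?lam j) \<and> (?a j = ?lam j \<longrightarrow> \<rho> j = b j)" if "j < e l" for j
      using \<rho>(1) that by blast
    show "indep_mod scale (W (m - 1)) {j. j < e l \<and> ?lam j = m} \<rho>" if "1 \<le> m" "m \<le> l" for m
      using \<rho>(2) that by blast
  qed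
qed

end

section \<open>Reduction modulo X and extension to k((X))\<close>

lemma red_nth [simp]: "red v $ i = (v $ i) $ 0"
  by (simp add: red_def)

lemma red_add [simp]: "red (x + y) = red x + red y"
  by (simp add: vec_eq_iff)

lemma red_zero [simp]: "red 0 = 0"
  by (simp add: vec_eq_iff)

lemma red_scale [simp]: "red (c *s x) = (c $ 0) *s red x"
  by (simp add: vec_eq_iff)

lemma red_sum: "red (\<Sum>j\<in>J. f j) = (\<Sum>j\<in>J. red (f j))"
  by (simp add: vec_eq_iff fps_sum_nth)

lemma red_fps_const [simp]: "red (\<chi> i. fps_const (u $ i)) = u"
  by (simp add: vec_eq_iff)

lemma range_red: "range red = UNIV"
  by (metis red_fps_const surjI)

lemma ext_nth [simp]: "ext v $ i = fps_to_fls (v $ i)"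
  by (simp add: ext_def)

lemma fps_to_fls_sum: "fps_to_fls (\<Sum>j\<in>J. f j) = (\<Sum>j\<in>J. fps_to_fls (f j))"
  by (induction J rule: infinite_finite_induct) auto

lemma ext_add [simp]: "ext (x + y) = ext x + ext y"
  by (simp add: vec_eq_iff)

lemma ext_zero [simp]: "ext 0 = 0"
  by (simp add: vec_eq_iff)

lemma ext_scale [simp]: "ext (c *s x) = fps_to_fls c *s ext x"
  by (simp add: vec_eq_iff fls_times_fps_to_fls)

lemma ext_sum: "ext (\<Sum>j\<in>J. f j) = (\<Sum>j\<in>J. ext (f j))"
  by (simp add: vec_eq_iff fps_to_fls_sum)

lemma ext_inject: "ext x = ext y \<longleftrightarrow> x = y"
  by (simp add: vec_eq_iff)

lemma fps_X_times_fps_shift_1: "f $ 0 = 0 \<Longrightarrow> fps_X * fps_shift (Suc 0) f = (f :: 'a::field fps)"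
  by (intro fps_ext) (auto simp: fps_X_mult_nth)

lemma red_eq_0_fps_X_factor: "red y = 0 \<Longrightarrow> y = fps_X *s (\<chi> i. fps_shift 1 (y $ i))"
  by (simp add: vec_eq_iff fps_X_times_fps_shift_1)

text \<open>For a submodule M of k[[X]]^n this says that M = (M \<otimes> k((X))) \<inter> k[[X]]^n; it is the
  only property of direct summands that the construction needs.\<close>

definition X_saturated :: "('a::field fps ^ 'n) set \<Rightarrow> bool"
  where "X_saturated M \<longleftrightarrow> (\<forall>y. fps_X *s y \<in> M \<longrightarrow> y \<in> M)"

lemma X_saturatedD: "X_saturated M \<Longrightarrow> fps_X *s y \<in> M \<Longrightarrow> y \<in> M"
  unfolding X_saturated_def by blast

lemma X_saturated_zero: "X_saturated ({0} :: ('a::field fps ^ 'n) set)"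
  by (simp add: X_saturated_def vec_eq_iff)

lemma X_saturated_power: "X_saturated M \<Longrightarrow> fps_X ^ N *s y \<in> M \<Longrightarrow> y \<in> M"
proof (induction N arbitrary: y)
  case (Suc N)
  have eq: "fps_X ^ Suc N *s y = fps_X ^ N *s (fps_X *s y)"
    by (simp add: vector_smult_assoc power_commutes)
  have "fps_X *s y \<in> M"
    using Suc.prems(2) unfolding eq by (rule Suc.IH[OF Suc.prems(1)])
  then show ?case
    by (rule X_saturatedD[OF Suc.prems(1)])
qed simp

lemma direct_summand_subspace: "direct_summand M \<Longrightarrow> Rmod.subspace M"
  unfolding direct_summand_def submoduleR_def scaleR_fps_eq by blast

lemma direct_summand_X_saturated:
  assumes "direct_summand (M :: ('a::field fps ^ 'n) set)"
  shows "X_saturated M"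
  unfolding X_saturated_def
proof (intro allI impI)
  obtain N where N: "Rmod.subspace N" "M \<inter> N = {0}" "{x + y | x y. x \<in> M \<and> y \<in> N} = UNIV"
    and M: "Rmod.subspace M"
    using assms unfolding direct_summand_def submoduleR_def scaleR_fps_eq by blast
  fix y :: "'a fps ^ 'n" assume y: "fps_X *s y \<in> M"
  obtain s t where st: "y = s + t" "s \<in> M" "t \<in> N"
    using N(3) by blast
  have "fps_X *s t = fps_X *s y - fps_X *s s"
    using st by (simp add: algebra_simps)
  also have "\<dots> \<in> M"
    by (intro Rmod.subspace_diff[OF M y] Rmod.subspace_scale[OF M st(2)])
  finally have "fps_X *s t \<in> M \<inter> N"
    using N(1) st by (auto intro: Rmod.subspace_scale)
  then have "t = 0"
    using N(2) by (auto simp: vec_eq_iff)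
  then show "y \<in> M"
    using st by simp
qed

text \<open>Over a saturated submodule it suffices to show that the coefficients of a relation have no
  constant term: then the relation can be divided by X, and so on.\<close>

lemma indep_mod_if_constant_coeffs_vanish:
  fixes M :: "('a::field fps ^ 'n) set" and u :: "'j \<Rightarrow> 'a fps ^ 'n"
  assumes M: "Rmod.subspace M" "X_saturated M" and fJ: "finite J"
    and vanish: "\<And>c. (\<Sum>j\<in>J. c j *s u j) \<in> M \<Longrightarrow> \<forall>j\<in>J. c j $ 0 = 0"
  shows "indep_mod (*s) M J u"
proof -
  have "\<forall>c. (\<Sum>j\<in>J. c j *s u j) \<in> M \<longrightarrow> (\<forall>j\<in>J. c j $ n = 0)" for n
  proof (induction n)
    case 0
    then show ?case using vanish by blast
  next
    case (Suc n)
    show ?case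
    proof (intro allI impI ballI)
      fix c j assume c: "(\<Sum>j\<in>J. c j *s u j) \<in> M" and j: "j \<in> J"
      define c' where "c' j = fps_shift 1 (c j)" for j
      have "(\<Sum>j\<in>J. c j *s u j) = (\<Sum>j\<in>J. fps_X *s (c' j *s u j))"
        using vanish[OF c] unfolding c'_def
        by (intro sum.cong) (simp_all add: fps_X_times_fps_shift_1 vector_smult_assoc)
      also have "\<dots> = fps_X *s (\<Sum>j\<in>J. c' j *s u j)"
        by (simp add: Rmod.scale_sum_right)
      finally have "(\<Sum>j\<in>J. c' j *s u j) \<in> M"
        using c M(2) by (auto dest: X_saturatedD)
      then show "c j $ Suc n = 0"
        using Suc j unfolding c'_def by auto
    qed
  qed
  then show ?thesis
    unfolding indep_mod_def by (auto intro: fps_ext)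
qed

lemma red_span: "red ` Rmod.span S = vec.span (red ` (S :: ('a::field fps ^ 'n) set))"
proof
  have "Rmod.span S \<subseteq> red -` vec.span (red ` S)"
    by (rule Rmod.span_minimal)
      (auto simp: Rmod.subspace_def intro: vec.span_base vec.span_add vec.span_scale vec.span_zero)
  then show "red ` Rmod.span S \<subseteq> vec.span (red ` S)"
    by auto
  have "vec.subspace (red ` Rmod.span S)"
    unfolding vec.subspace_def
  proof (intro conjI ballI allI)
    show "0 \<in> red ` Rmod.span S"
      using Rmod.span_zero by force
    fix x y assume "x \<in> red ` Rmod.span S" "y \<in> red ` Rmod.span S"
    then show "x + y \<in> red ` Rmod.span S"
      by (auto intro!: image_eqI[where x = "_ + _"] Rmod.span_add simp del: red_add simp: red_add[symmetric])
  next
    fix c x assume "x \<in> red ` Rmod.span S"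
    then obtain x' where "x = red x'" "x' \<in> Rmod.span S"
      by auto
    then show "c *s x \<in> red ` Rmod.span S"
      by (intro image_eqI[of _ _ "fps_const c *s x'"]) (auto intro: Rmod.span_scale)
  qed
  then show "vec.span (red ` S) \<subseteq> red ` Rmod.span S"
    using Rmod.span_superset by (intro vec.span_minimal) auto
qed

lemma subspace_red_image: "Rmod.subspace M \<Longrightarrow> vec.subspace (red ` (M :: ('a::field fps ^ 'n) set))"
  using red_span[of M] Rmod.span_eq_iff[of M] by (metis vec.subspace_span)

lemma dim_red_free:
  fixes M :: "('a::field fps ^ 'n) set"
  assumes ds: "direct_summand M" and fr: "free_of_rank M r"
  shows "vec.dim (red ` M) = r"
proof -
  obtain B where B: "finite B" "card B = r" "\<not> Rmod.dependent B" "Rmod.span B = M"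
    using fr unfolding free_of_rank_def scaleR_fps_eq by blast
  have indB: "indep_mod (*s) {0} B (\<lambda>b. b)"
    using Rmod.indep_mod_zeroI[of "\<lambda>b. b" B] B(1,3) by simp
  have ind: "indep_mod (*s) {0} B red"
    unfolding indep_mod_def
  proof (intro allI impI)
    fix \<gamma> assume "(\<Sum>b\<in>B. \<gamma> b *s red b) \<in> {0}"
    define y where "y = (\<Sum>b\<in>B. fps_const (\<gamma> b) *s b)"
    have yM: "y \<in> M"
      unfolding y_def B(4)[symmetric] by (intro Rmod.span_sum Rmod.span_scale Rmod.span_base)
    have "red y = 0"
      using \<open>(\<Sum>b\<in>B. \<gamma> b *s red b) \<in> {0}\<close> unfolding y_def by (simp add: red_sum)
    then have ysp: "y = fps_X *s (\<chi> i. fps_shift 1 (y $ i))"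
      by (rule red_eq_0_fps_X_factor)
    then have "(\<chi> i. fps_shift 1 (y $ i)) \<in> M"
      using yM direct_summand_X_saturated[OF ds] by (metis X_saturatedD)
    then obtain a where a: "(\<chi> i. fps_shift 1 (y $ i)) = (\<Sum>b\<in>B. a b *s b)"
      using B(1,4) Rmod.span_finite[of B] by auto
    have "(\<Sum>b\<in>B. (fps_const (\<gamma> b) - fps_X * a b) *s b) = y - fps_X *s (\<Sum>b\<in>B. a b *s b)"
      unfolding y_def
      by (simp add: Rmod.scale_left_diff_distrib sum_subtractf Rmod.scale_sum_right vector_smult_assoc)
    also have "\<dots> = 0"
      using ysp a by simp
    finally have "(\<Sum>b\<in>B. (fps_const (\<gamma> b) - fps_X * a b) *s b) \<in> {0}"
      by simp
    note coeffs = Rmod.indep_modD[OF indB this]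
    show "\<forall>b\<in>B. \<gamma> b = 0"
    proof
      fix b assume "b \<in> B"
      then have "(fps_const (\<gamma> b) - fps_X * a b) $ 0 = 0"
        using coeffs[OF \<open>b \<in> B\<close>] by simp
      then show "\<gamma> b = 0"
        by simp
    qed
  qed
  have "vec.dim (red ` M) = vec.dim (vec.span (red ` B))"
    using B(4) red_span by metis
  also have "\<dots> = card (red ` B)"
    by (rule vec.dim_span_eq_card_independent[OF vec.indep_mod_zero_independent[OF ind B(1)]])
  also have "\<dots> = r"
    using card_image[OF vec.indep_mod_zero_inj_on[OF ind B(1)]] B(2) by simp
  finally show ?thesis .
qed

lemma fls_X_power_times_eq_fps: "\<exists>N0. \<forall>N\<ge>N0. \<exists>f. fls_X ^ N * (g :: 'a::field fls) = fps_to_fls f"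
proof (intro exI[of _ "nat (- fls_subdegree g)"] allI impI)
  fix N assume "N \<ge> nat (- fls_subdegree g)"
  then have "int N \<ge> - fls_subdegree g"
    by linarith
  then obtain f where "g = fls_shift (int N) (fps_to_fls f)"
    by (rule fls_as_fps)
  then show "\<exists>f. fls_X ^ N * g = fps_to_fls f"
    by (auto simp: fls_X_power_times_conv_shift)
qed

lemma fls_X_power_clears_denominators:
  fixes r :: "'j \<Rightarrow> 'a::field fls"
  assumes "finite T"
  obtains N f where "\<forall>a\<in>T. fls_X ^ N * r a = fps_to_fls (f a)"
proof -
  have "\<exists>N0. \<forall>N\<ge>N0. \<forall>a\<in>T. \<exists>f. fls_X ^ N * r a = fps_to_fls f"
    using assms
  proof (induction T rule: finite_induct)
    case (insert x T)
    then obtain N1 where N1: "\<forall>N\<ge>N1. \<forall>a\<in>T. \<exists>f. fls_X ^ N * r a = fps_to_fls f"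
      by blast
    obtain N2 where N2: "\<forall>N\<ge>N2. \<exists>f. fls_X ^ N * r x = fps_to_fls f"
      using fls_X_power_times_eq_fps by blast
    show ?case
      using N1 N2 by (intro exI[of _ "max N1 N2"]) auto
  qed simp
  then obtain N where "\<forall>a\<in>T. \<exists>f. fls_X ^ N * r a = fps_to_fls f"
    by blast
  then obtain f where "\<forall>a\<in>T. fls_X ^ N * r a = fps_to_fls (f a)"
    by (metis bchoice)
  then show ?thesis
    using that by blast
qed

lemma tensor_K_eq: "tensor_K M = vec.span (ext ` M)"
  by (simp add: tensor_K_def scale_K_eq)

lemma mem_if_ext_mem_tensor_K:
  fixes M :: "('a::field fps ^ 'n) set"
  assumes M: "Rmod.subspace M" "X_saturated M" and y: "ext y \<in> tensor_K M"
  shows "y \<in> M"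
proof -
  obtain t r where tr: "ext y = (\<Sum>a\<in>t. r a *s a)" "finite t" "t \<subseteq> ext ` M"
    using y unfolding tensor_K_eq vec.span_explicit by blast
  obtain N f where f: "\<forall>a\<in>t. fls_X ^ N * r a = fps_to_fls (f a)"
    using fls_X_power_clears_denominators[OF tr(2)] by blast
  have "\<forall>a\<in>t. \<exists>m. m \<in> M \<and> ext m = a"
    using tr(3) by blast
  then obtain m where m: "\<forall>a\<in>t. m a \<in> M \<and> ext (m a) = a"
    by (metis bchoice)
  have "ext (fps_X ^ N *s y) = fls_X ^ N *s ext y"
    by (simp only: ext_scale fps_to_fls_power fps_X_to_fls)
  also have "\<dots> = (\<Sum>a\<in>t. (fls_X ^ N * r a) *s a)"
    unfolding tr(1) by (simp only: vec.scale_sum_right vec.scale_scale)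
  also have "\<dots> = (\<Sum>a\<in>t. fps_to_fls (f a) *s ext (m a))"
    using f m by (intro sum.cong) auto
  also have "\<dots> = ext (\<Sum>a\<in>t. f a *s m a)"
    by (simp add: ext_sum)
  finally have "fps_X ^ N *s y = (\<Sum>a\<in>t. f a *s m a)"
    by (simp only: ext_inject)
  also have "\<dots> \<in> M"
    using m M(1) by (intro Rmod.subspace_sum Rmod.subspace_scale) auto
  finally show ?thesis
    using X_saturated_power[OF M(2)] by blast
qed

lemma indep_mod_tensor_K:
  fixes M :: "('a::field fps ^ 'n) set" and u :: "'j \<Rightarrow> 'a fps ^ 'n"
  assumes M: "Rmod.subspace M" "X_saturated M" and fJ: "finite J" and ind: "indep_mod (*s) M J u"
  shows "indep_mod (*s) (tensor_K M) J (\<lambda>j. ext (u j))"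
  unfolding indep_mod_def
proof (intro allI impI ballI)
  fix c j assume sum: "(\<Sum>j\<in>J. c j *s ext (u j)) \<in> tensor_K M" and j: "j \<in> J"
  obtain N f where f: "\<forall>a\<in>J. fls_X ^ N * c a = fps_to_fls (f a)"
    using fls_X_power_clears_denominators[OF fJ] by blast
  have "ext (\<Sum>a\<in>J. f a *s u a) = (\<Sum>a\<in>J. fps_to_fls (f a) *s ext (u a))"
    by (simp add: ext_sum)
  also have "\<dots> = (\<Sum>a\<in>J. (fls_X ^ N * c a) *s ext (u a))"
    using f by (intro sum.cong) auto
  also have "\<dots> = fls_X ^ N *s (\<Sum>a\<in>J. c a *s ext (u a))"
    by (simp only: vec.scale_sum_right vec.scale_scale)
  also have "\<dots> \<in> tensor_K M"
    using sum unfolding tensor_K_eq by (rule vec.span_scale)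
  finally have "(\<Sum>a\<in>J. f a *s u a) \<in> M"
    by (rule mem_if_ext_mem_tensor_K[OF M])
  from Rmod.indep_modD[OF ind this j] have "f j = 0" .
  then have "fls_X ^ N * c j = 0"
    using f j by simp
  then show "c j = 0"
    by simp
qed

lemma span_ext_span: "vec.span (ext ` Rmod.span S) = vec.span (ext ` (S :: ('a::field fps ^ 'n) set))"
proof
  have "Rmod.span S \<subseteq> ext -` vec.span (ext ` S)"
    by (rule Rmod.span_minimal)
      (auto simp: Rmod.subspace_def intro: vec.span_base vec.span_add vec.span_scale vec.span_zero)
  then show "vec.span (ext ` Rmod.span S) \<subseteq> vec.span (ext ` S)"
    by (intro vec.span_minimal) auto
  show "vec.span (ext ` S) \<subseteq> vec.span (ext ` Rmod.span S)"
    using Rmod.span_superset by (intro vec.span_mono) auto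
qed

lemma det_map_ring_hom:
  fixes f :: "'a::comm_ring_1 \<Rightarrow> 'b::comm_ring_1"
  assumes add: "\<And>x y. f (x + y) = f x + f y" and mult: "\<And>x y. f (x * y) = f x * f y"
    and one: "f 1 = 1" and neg: "\<And>x. f (- x) = - f x"
  shows "det (\<chi> i j. f (A$i$j)) = f (det (A::'a^'n^'n))"
proof -
  interpret F: additive f
    by unfold_locales (rule add)
  have prod: "f (prod g S) = prod (\<lambda>i. f (g i)) S" for g :: "'n \<Rightarrow> 'a" and S :: "'n set"
    by (induction S rule: infinite_finite_induct) (auto simp: one mult)
  have sign: "f (of_int (sign p)) = of_int (sign p)" for p :: "'n \<Rightarrow> 'n"
    by (simp add: sign_def one neg)
  show ?thesis
    unfolding det_def by (simp add: F.sum mult prod sign)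
qed

lemma det_fps_nth_0: "det (\<chi> i j. (A$i$j) $ 0) = (det (A::'a::field fps^'n^'n)) $ 0"
  by (rule det_map_ring_hom) auto

lemma det_fps_to_fls: "det (\<chi> i j. fps_to_fls (A$i$j)) = fps_to_fls (det (A::'a::field fps^'n^'n))"
  by (rule det_map_ring_hom) (auto simp: fls_times_fps_to_fls)

text \<open>The solution given by Cramer's rule over k((X)) has its coefficients in k[[X]], as the
  determinant is a unit there.\<close>

lemma fps_matrix_surj:
  fixes A :: "'a::field fps ^'n^'n"
  assumes "det A $ 0 \<noteq> 0"
  shows "\<exists>y. A *v y = x"
proof -
  define AK :: "'a fls ^'n^'n" where "AK = (\<chi> i j. fps_to_fls (A $ i $ j))"
  have dAK: "det AK = fps_to_fls (det A)"
    unfolding AK_def by (rule det_fps_to_fls)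
  have dA: "det A \<noteq> 0"
    using assms by auto
  then have dAK0: "det AK \<noteq> 0"
    using dAK by simp
  have inv: "fps_to_fls (inverse (det A)) * fps_to_fls (det A) = 1"
    using inverse_mult_eq_1[OF assms] by (simp flip: fls_times_fps_to_fls)
  define D where "D k = det (\<chi> i j. if j = k then x $ i else A $ i $ j)" for k
  define y where "y = (\<chi> k. D k * inverse (det A))"
  have "ext y $ k = det (\<chi> i j. if j = k then ext x $ i else AK $ i $ j) / det AK" for k
  proof -
    have "(\<chi> i j. if j = k then ext x $ i else AK $ i $ j) =
        (\<chi> i j. fps_to_fls ((\<chi> i j. if j = k then x $ i else A $ i $ j) $ i $ j))"
      by (simp add: vec_eq_iff AK_def)
    then have Dk: "det (\<chi> i j. if j = k then ext x $ i else AK $ i $ j) = fps_to_fls (D k)"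
      unfolding D_def by (simp only: det_fps_to_fls)
    have "ext y $ k = fps_to_fls (D k) * fps_to_fls (inverse (det A))"
      by (simp add: y_def fls_times_fps_to_fls)
    also have "\<dots> = fps_to_fls (D k) / det AK"
      using inv dAK0 dAK by (simp add: field_simps)
    finally show ?thesis
      unfolding Dk .
  qed
  then have "ext y = (\<chi> k. det (\<chi> i j. if j = k then ext x $ i else AK $ i $ j) / det AK)"
    by (simp add: vec_eq_iff)
  then have "AK *v ext y = ext x"
    by (subst cramer[OF dAK0])
  moreover have "ext (A *v y) = AK *v ext y"
    by (simp add: vec_eq_iff matrix_vector_mult_def AK_def fps_to_fls_sum fls_times_fps_to_fls)
  ultimately show ?thesis
    by (auto simp: ext_inject)
qed

lemma span_eq_UNIV_if_red_independent:
  fixes z :: "'j \<Rightarrow> 'a::field fps ^ 'n"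
  assumes fJ: "finite J" and cJ: "card J = CARD('n)" and ind: "indep_mod (*s) {0} J (\<lambda>j. red (z j))"
  shows "Rmod.span (z ` J) = UNIV"
proof -
  obtain e where e: "bij_betw e (UNIV :: 'n set) J"
    using finite_same_card_bij[of "UNIV :: 'n set" J] fJ cJ by auto
  define A :: "'a fps ^'n^'n" where "A = (\<chi> i k. z (e k) $ i)"
  define Ab :: "'a ^'n^'n" where "Ab = (\<chi> i k. (A $ i $ k) $ 0)"
  have kernel: "Ab *v w = 0 \<Longrightarrow> w = 0" for w
  proof -
    assume w: "Ab *v w = 0"
    have "Ab *v w = (\<Sum>k\<in>UNIV. w $ k *s red (z (e k)))"
      by (simp add: vec_eq_iff matrix_vector_mult_def Ab_def A_def mult.commute)
    also have "\<dots> = (\<Sum>j\<in>J. w $ (inv_into UNIV e j) *s red (z j))"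
      using bij_betw_imp_inj_on[OF e]
      by (simp add: sum.reindex_bij_betw[OF e, symmetric] inv_into_f_f)
    finally have zero: "\<forall>j\<in>J. w $ (inv_into UNIV e j) = 0"
      using w ind unfolding indep_mod_def by auto
    show "w = 0"
    proof (subst vec_eq_iff, intro allI)
      fix k
      have "w $ (inv_into UNIV e (e k)) = 0"
        using zero bij_betwE[OF e] by blast
      then show "w $ k = 0 $ k"
        using bij_betw_imp_inj_on[OF e] by (simp add: inv_into_f_f)
    qed
  qed
  have "inj ((*v) Ab)"
  proof (rule injI)
    fix x y assume "Ab *v x = Ab *v y"
    then have "Ab *v (x - y) = 0"
      by (simp add: matrix_vector_mult_diff_distrib)
    then have "x - y = 0"
      by (rule kernel)
    then show "x = y"
      by simp
  qed
  then have "det Ab \<noteq> 0"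
    using det_nz_iff_inj_gen[OF matrix_vector_mul_linear_gen[of Ab]]
    by (simp add: matrix_of_matrix_vector_mul[unfolded eta_contract_eq])
  then have "det A $ 0 \<noteq> 0"
    using det_fps_nth_0[of A] unfolding Ab_def by simp
  have "x \<in> Rmod.span (z ` J)" for x
  proof -
    obtain y where "A *v y = x"
      using fps_matrix_surj[OF \<open>det A $ 0 \<noteq> 0\<close>] by blast
    moreover have "A *v y = (\<Sum>k\<in>UNIV. y $ k *s z (e k))"
      by (simp add: vec_eq_iff matrix_vector_mult_def A_def mult.commute)
    moreover have "(\<Sum>k\<in>UNIV. y $ k *s z (e k)) \<in> Rmod.span (z ` J)"
      using bij_betwE[OF e] by (intro Rmod.span_sum Rmod.span_scale Rmod.span_base) auto
    ultimately show ?thesis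
      by simp
  qed
  then show ?thesis
    by auto
qed

section \<open>Lifting residues\<close>

lemma constant_coeffs_eq_0_if_red_indep_mod:
  fixes M :: "('a::field fps ^ 'n) set" and c :: "'j \<Rightarrow> 'a fps" and r :: "'j \<Rightarrow> 'a fps ^ 'n"
  assumes ind: "indep_mod (*s) (red ` M) J \<rho>" and sum: "(\<Sum>j\<in>J. c j *s r j) \<in> M"
    and red: "\<forall>j\<in>J. red (r j) = \<rho> j"
  shows "\<forall>j\<in>J. c j $ 0 = 0"
proof -
  have "red (\<Sum>j\<in>J. c j *s r j) = (\<Sum>j\<in>J. (c j $ 0) *s \<rho> j)"
    using red by (simp add: red_sum)
  then have "(\<Sum>j\<in>J. (c j $ 0) *s \<rho> j) \<in> red ` M"
    using sum by (metis image_eqI)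
  from vec.indep_modD[OF ind this] show ?thesis
    by blast
qed

text \<open>Reducing a relation modulo X shows that the coefficients of the indices in N have no
  constant term; after dividing them by X the relation becomes X times a relation between lifts of
  the residues, which saturation allows to reduce once more.\<close>

lemma indep_mod_lift:
  fixes M :: "('a::field fps ^ 'n) set" and g w :: "'j \<Rightarrow> 'a fps ^ 'n" and \<rho> :: "'j \<Rightarrow> 'a ^ 'n"
  assumes M: "Rmod.subspace M" "X_saturated M" and fJ: "finite J"
    and nat: "\<And>j. j \<in> J \<Longrightarrow> j \<in> N \<Longrightarrow> w j = 0 \<and> red (g j) = \<rho> j"
    and push: "\<And>j. j \<in> J \<Longrightarrow> j \<notin> N \<Longrightarrow> g j \<in> M \<and> red (w j) = \<rho> j"
    and ind: "indep_mod (*s) (red ` M) J \<rho>"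
  shows "indep_mod (*s) M J (\<lambda>j. g j + fps_X *s w j)"
proof (rule indep_mod_if_constant_coeffs_vanish[OF M fJ])
  fix c assume sum: "(\<Sum>j\<in>J. c j *s (g j + fps_X *s w j)) \<in> M"
  define r where "r j = (if j \<in> N then g j else w j)" for j
  define c' where "c' j = (if j \<in> N then c j else fps_X * c j)" for j
  have red_r: "\<forall>j\<in>J. red (r j) = \<rho> j"
    using nat push by (simp add: r_def)
  have "(\<Sum>j\<in>J. c j *s (g j + fps_X *s w j)) =
      (\<Sum>j\<in>J. (if j \<in> N then 0 else c j *s g j) + c' j *s r j)"
    using nat by (intro sum.cong) (auto simp: r_def c'_def vector_add_ldistrib vector_smult_assoc mult.commute)
  also have "\<dots> = (\<Sum>j\<in>J. if j \<in> N then 0 else c j *s g j) + (\<Sum>j\<in>J. c' j *s r j)"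
    by (rule sum.distrib)
  finally have "(\<Sum>j\<in>J. c' j *s r j) =
      (\<Sum>j\<in>J. c j *s (g j + fps_X *s w j)) - (\<Sum>j\<in>J. if j \<in> N then 0 else c j *s g j)"
    by simp
  also have "\<dots> \<in> M"
    using push by (intro Rmod.subspace_diff[OF M(1) sum] Rmod.subspace_sum[OF M(1)])
      (auto intro: Rmod.subspace_scale[OF M(1)] Rmod.subspace_0[OF M(1)])
  finally have rM: "(\<Sum>j\<in>J. c' j *s r j) \<in> M" .
  then have "\<forall>j\<in>J. c' j $ 0 = 0"
    by (rule constant_coeffs_eq_0_if_red_indep_mod[OF ind _ red_r])
  then have cN: "c j $ 0 = 0" if "j \<in> J" "j \<in> N" for j
    using that by (auto simp: c'_def)
  define q where "q j = (if j \<in> N then fps_shift 1 (c j) else c j)" for j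
  have "(\<Sum>j\<in>J. c' j *s r j) = (\<Sum>j\<in>J. fps_X *s (q j *s r j))"
    using cN by (intro sum.cong) (auto simp: c'_def q_def vector_smult_assoc fps_X_times_fps_shift_1)
  also have "\<dots> = fps_X *s (\<Sum>j\<in>J. q j *s r j)"
    by (simp add: Rmod.scale_sum_right)
  finally have "(\<Sum>j\<in>J. q j *s r j) \<in> M"
    using rM M(2) by (auto dest: X_saturatedD)
  then have q0: "\<forall>j\<in>J. q j $ 0 = 0"
    by (rule constant_coeffs_eq_0_if_red_indep_mod[OF ind _ red_r])
  show "\<forall>j\<in>J. c j $ 0 = 0"
  proof
    fix j assume j: "j \<in> J"
    show "c j $ 0 = 0"
    proof (cases "j \<in> N")
      case False
      have "q j $ 0 = 0"
        using q0 j by blast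
      with False show ?thesis
        by (simp add: q_def)
    qed (use cN j in blast)
  qed
qed

lemma direct_summand_span:
  fixes v :: "nat \<Rightarrow> 'a::field fps ^ 'n"
  assumes ind: "indep_mod (*s) {0} {..<d} (\<lambda>j. red (v j))"
  shows "direct_summand (Rmod.span (v ` {..<d}))"
proof -
  define n where "n = CARD('n)"
  have "card ((\<lambda>j. red (v j)) ` {..<d}) \<le> vec.dim (UNIV :: ('a ^ 'n) set)"
    using vec.indep_mod_zero_independent[OF ind] by (intro vec.independent_card_le_dim) auto
  also have dim: "vec.dim (UNIV :: ('a ^ 'n) set) = n"
    unfolding n_def by (rule vec_dim_card)
  finally have dn: "d \<le> n"
    using card_image[OF vec.indep_mod_zero_inj_on[OF ind]] by simp
  obtain b where b: "\<forall>j<d. b j = red (v j)" "indep_mod (*s) {0} {..<n} b"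
    using vec.extend_indep_family[OF ind vec.subspace_UNIV] unfolding dim by blast
  define z where "z j = (if j < d then v j else (\<chi> i. fps_const (b j $ i)))" for j
  have zb: "red (z j) = b j" if "j \<in> {..<n}" for j
    using b(1) by (simp add: z_def)
  have red_z: "indep_mod (*s) {0} {..<n} (\<lambda>j. red (z j))"
    using b(2) vec.indep_mod_cong[of "{..<n}" "\<lambda>j. red (z j)" b, OF zb] by simp
  have span: "Rmod.span (z ` {..<n}) = UNIV"
    by (rule span_eq_UNIV_if_red_independent[OF _ _ red_z]) (simp_all add: n_def)
  have Rind: "indep_mod (*s) {0} {..<n} z"
  proof (rule indep_mod_if_constant_coeffs_vanish)
    fix c assume sum: "(\<Sum>j\<in>{..<n}. c j *s z j) \<in> {0}"
    have "indep_mod (*s) (red ` {0}) {..<n} (\<lambda>j. red (z j))"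
      using red_z by simp
    then show "\<forall>j\<in>{..<n}. c j $ 0 = 0"
      using sum by (rule constant_coeffs_eq_0_if_red_indep_mod) simp
  qed (simp_all add: Rmod.subspace_single_0 X_saturated_zero)
  have n: "{..<d} \<union> {d..<n} = {..<n}"
    using dn by (rule ivl_disj_un_one(2))
  have inter: "Rmod.span (z ` {..<d}) \<inter> Rmod.span (z ` {d..<n}) = {0}"
  proof (rule Rmod.span_inter_span_indep_mod_zero)
    show "indep_mod (*s) {0} ({..<d} \<union> {d..<n}) z"
      unfolding n by (rule Rind)
  qed auto
  have sum: "{x + y | x y. x \<in> Rmod.span (z ` {..<d}) \<and> y \<in> Rmod.span (z ` {d..<n})} = UNIV"
    using span Rmod.span_Un[of "z ` {..<d}" "z ` {d..<n}"] by (simp add: image_Un[symmetric] n)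
  have zv: "z ` {..<d} = v ` {..<d}"
    by (auto simp: z_def)
  show ?thesis
    unfolding direct_summand_def submoduleR_def scaleR_fps_eq zv[symmetric]
    using inter sum Rmod.subspace_span by blast
qed

lemma obtain_red_lifts:
  assumes "\<And>j. j < d \<Longrightarrow> b j \<in> red ` S j"
  obtains g where "\<And>j. j < d \<Longrightarrow> g j \<in> S j \<and> red (g j) = b j"
proof -
  have "\<forall>j\<in>{..<d}. \<exists>y. y \<in> S j \<and> red y = b j"
    using assms by (metis imageE lessThan_iff)
  then obtain g where "\<forall>j\<in>{..<d}. g j \<in> S j \<and> red (g j) = b j"
    by (rule bchoice[THEN exE])
  then show ?thesis
    by (intro that[of g]) simp
qed

lemma exists_lift_indep_mod_levels:
  fixes Ms :: "nat \<Rightarrow> ('a::field fps ^ 'n) set" and b \<rho> :: "nat \<Rightarrow> 'a ^ 'n" and lam a :: "nat \<Rightarrow> nat"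
  assumes Ms: "\<And>i. i \<le> l \<Longrightarrow> Rmod.subspace (Ms i) \<and> X_saturated (Ms i)"
    and mono: "\<And>i. i < l \<Longrightarrow> Ms i \<subseteq> Ms (Suc i)"
    and lam: "\<And>j. j < d \<Longrightarrow> a j \<le> lam j \<and> lam j \<le> l"
    and b: "\<And>j. j < d \<Longrightarrow> b j \<in> red ` Ms (a j)"
    and \<rho>: "\<And>j. j < d \<Longrightarrow> \<rho> j \<in> red ` Ms (lam j) \<and> (a j = lam j \<longrightarrow> \<rho> j = b j)"
    and ind: "\<And>m. 1 \<le> m \<Longrightarrow> m \<le> l \<Longrightarrow> indep_mod (*s) (red ` Ms (m - 1)) {j. j < d \<and> lam j = m} \<rho>"
  shows "\<exists>v. (\<forall>j<d. red (v j) = b j \<and> v j \<in> Ms (lam j)) \<and>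
    (\<forall>m. 1 \<le> m \<and> m \<le> l \<longrightarrow> indep_mod (*s) (Ms (m - 1)) {j. j < d \<and> lam j = m} v)"
proof -
  note Mmono = lift_Suc_mono_le_bounded[of l Ms, OF mono]
  obtain g where g: "\<And>j. j < d \<Longrightarrow> g j \<in> Ms (a j) \<and> red (g j) = b j"
    using obtain_red_lifts[of d b "\<lambda>j. Ms (a j)"] b by blast
  obtain w0 where w0: "\<And>j. j < d \<Longrightarrow> w0 j \<in> Ms (lam j) \<and> red (w0 j) = \<rho> j"
    using obtain_red_lifts[of d \<rho> "\<lambda>j. Ms (lam j)"] \<rho> by blast
  define w where "w j = (if a j = lam j then 0 else w0 j)" for j
  define v where "v j = g j + fps_X *s w j" for j
  have "red (v j) = b j \<and> v j \<in> Ms (lam j)" if j: "j < d" for j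
  proof
    show "red (v j) = b j"
      using g[OF j] by (simp add: v_def)
    have "Ms (a j) \<subseteq> Ms (lam j)"
      using lam[OF j] by (intro Mmono) auto
    moreover have "w j \<in> Ms (lam j)"
      using w0[OF j] Ms[of "lam j"] lam[OF j] by (auto simp: w_def intro: Rmod.subspace_0)
    ultimately show "v j \<in> Ms (lam j)"
      using g[OF j] Ms[of "lam j"] lam[OF j] unfolding v_def
      by (intro Rmod.subspace_add Rmod.subspace_scale) auto
  qed
  moreover have "indep_mod (*s) (Ms (m - 1)) {j. j < d \<and> lam j = m} v" if m: "1 \<le> m" "m \<le> l" for m
    unfolding v_def
  proof (rule indep_mod_lift[where N = "{j. a j = m}"])
    show "Rmod.subspace (Ms (m - 1))" "X_saturated (Ms (m - 1))"
      using Ms[of "m - 1"] m by auto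
    show "w j = 0 \<and> red (g j) = \<rho> j" if "j \<in> {j. j < d \<and> lam j = m}" "j \<in> {j. a j = m}" for j
      using that g \<rho> by (auto simp: w_def)
    show "g j \<in> Ms (m - 1) \<and> red (w j) = \<rho> j" if "j \<in> {j. j < d \<and> lam j = m}" "j \<notin> {j. a j = m}" for j
    proof -
      have j: "j < d" "lam j = m" "a j \<noteq> m"
        using that by auto
      then have "Ms (a j) \<subseteq> Ms (m - 1)"
        using lam[OF j(1)] m by (intro Mmono) auto
      then show ?thesis
        using g[OF j(1)] w0[OF j(1)] j by (auto simp: w_def)
    qed
  qed (use ind[OF m] in auto)
  ultimately show ?thesis
    by blast
qed

lemma dim_tensor_K_span_inter:
  fixes Ms :: "nat \<Rightarrow> ('a::field fps ^ 'n) set" and v :: "nat \<Rightarrow> 'a fps ^ 'n" and lam :: "nat \<Rightarrow> nat"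
  assumes Ms: "\<And>i. i \<le> l \<Longrightarrow> Rmod.subspace (Ms i) \<and> X_saturated (Ms i)"
    and mono: "\<And>i. i < l \<Longrightarrow> Ms i \<subseteq> Ms (Suc i)"
    and lev: "\<And>j. j < d \<Longrightarrow> 1 \<le> lam j \<and> lam j \<le> l \<and> v j \<in> Ms (lam j)"
    and ind: "\<And>m. 1 \<le> m \<Longrightarrow> m \<le> l \<Longrightarrow> indep_mod (*s) (Ms (m - 1)) {j. j < d \<and> lam j = m} v"
    and i: "i \<le> l"
  shows "dim_K (tensor_K (Rmod.span (v ` {..<d})) \<inter> tensor_K (Ms i)) = card {j. j < d \<and> lam j \<le> i}"
proof -
  have "tensor_K (Rmod.span (v ` {..<d})) = vec.span ((\<lambda>j. ext (v j)) ` {..<d})"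
    unfolding tensor_K_eq span_ext_span by (simp add: image_image)
  moreover have "vec.dim (vec.span ((\<lambda>j. ext (v j)) ` {..<d}) \<inter> tensor_K (Ms i)) =
      card {j\<in>{..<d}. lam j \<le> i}"
  proof (rule vec.dim_span_inter_flag[where F = "\<lambda>i. tensor_K (Ms i)" and l = l])
    show "vec.subspace (tensor_K (Ms i))" for i
      unfolding tensor_K_eq by simp
    show "tensor_K (Ms i) \<subseteq> tensor_K (Ms (Suc i))" if "i < l" for i
      unfolding tensor_K_eq using mono[OF that] by (intro vec.span_mono image_mono)
    show "1 \<le> lam j \<and> lam j \<le> l \<and> ext (v j) \<in> tensor_K (Ms (lam j))" if "j \<in> {..<d}" for j
      using lev that unfolding tensor_K_eq by (auto intro: vec.span_base)
    show "indep_mod (*s) (tensor_K (Ms (m - 1))) {j\<in>{..<d}. lam j = m} (\<lambda>j. ext (v j))"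
      if "1 \<le> m" "m \<le> l" for m
      using indep_mod_tensor_K[of "Ms (m - 1)" "{j. j < d \<and> lam j = m}" v] Ms[of "m - 1"] ind[OF that] that
      by simp
  qed (use i in simp_all)
  ultimately show ?thesis
    unfolding dim_K_def scale_K_eq by simp
qed

lemma exists_direct_summand_with_levels:
  fixes Ms :: "nat \<Rightarrow> ('a::field fps ^ 'n) set" and Lbar :: "('a ^ 'n) set" and e :: "nat \<Rightarrow> nat"
  assumes ds: "\<And>i. i \<le> l \<Longrightarrow> direct_summand (Ms i)" and mono: "\<And>i. i < l \<Longrightarrow> Ms i \<subseteq> Ms (Suc i)"
    and Ml: "Ms l = UNIV" and Lbar: "vec.subspace Lbar"
    and e0: "e 0 = 0" and el: "e l = vec.dim Lbar"
    and e_mono: "\<And>i. i < l \<Longrightarrow> e i \<le> e (Suc i)"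
    and e_step: "\<And>i. i < l \<Longrightarrow> e (Suc i) + vec.dim (red ` Ms i) \<le> vec.dim (red ` Ms (Suc i)) + e i"
    and e_le: "\<And>i. i \<le> l \<Longrightarrow> e i \<le> vec.dim (Lbar \<inter> red ` Ms i)"
  obtains L where "direct_summand L" "red ` L = Lbar"
    and "\<And>i. i \<le> l \<Longrightarrow> dim_K (tensor_K L \<inter> tensor_K (Ms i)) = e i"
proof -
  have Ms: "Rmod.subspace (Ms i) \<and> X_saturated (Ms i)" if "i \<le> l" for i
    using ds[OF that] by (simp add: direct_summand_subspace direct_summand_X_saturated)
  have sub: "vec.subspace (red ` Ms i)" if "i \<le> l" for i
    using Ms[OF that] subspace_red_image by blast
  have mono': "red ` Ms i \<subseteq> red ` Ms (Suc i)" if "i < l" for i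
    using mono[OF that] by (rule image_mono)
  have Lsub: "Lbar \<subseteq> red ` Ms l"
    using Ml by (simp add: range_red)
  obtain b a \<rho> where b: "indep_mod (*s) {0} {..<e l} b" "vec.span (b ` {..<e l}) = Lbar"
    and a: "\<And>j. j < e l \<Longrightarrow> a j \<le> first_level e j \<and> b j \<in> red ` Ms (a j)"
    and \<rho>: "\<And>j. j < e l \<Longrightarrow> \<rho> j \<in> red ` Ms (first_level e j) \<and> (a j = first_level e j \<longrightarrow> \<rho> j = b j)"
    and ind: "\<And>m. 1 \<le> m \<Longrightarrow> m \<le> l \<Longrightarrow>
      indep_mod (*s) (red ` Ms (m - 1)) {j. j < e l \<and> first_level e j = m} \<rho>"
    using vec.exists_adapted_basis_and_residues[of l "\<lambda>i. red ` Ms i" Lbar e,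
      OF sub mono' Lbar Lsub e0 el e_mono e_step e_le] by blast
  note lev = first_level_bounds[of e, OF e0]
  have "\<exists>v. (\<forall>j<e l. red (v j) = b j \<and> v j \<in> Ms (first_level e j)) \<and>
      (\<forall>m. 1 \<le> m \<and> m \<le> l \<longrightarrow> indep_mod (*s) (Ms (m - 1)) {j. j < e l \<and> first_level e j = m} v)"
    by (rule exists_lift_indep_mod_levels[where a = a and \<rho> = \<rho>]) (use Ms mono a \<rho> ind lev in auto)
  then obtain v where v: "\<forall>j<e l. red (v j) = b j \<and> v j \<in> Ms (first_level e j)"
    "\<forall>m. 1 \<le> m \<and> m \<le> l \<longrightarrow> indep_mod (*s) (Ms (m - 1)) {j. j < e l \<and> first_level e j = m} v"
    by blast
  show ?thesis
  proof (rule that[of "Rmod.span (v ` {..<e l})"])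
    show "direct_summand (Rmod.span (v ` {..<e l}))"
      using b(1) v(1) vec.indep_mod_cong[of "{..<e l}" "\<lambda>j. red (v j)" b]
      by (intro direct_summand_span) simp
    have "(\<lambda>j. red (v j)) ` {..<e l} = b ` {..<e l}"
      using v(1) by (intro image_cong) auto
    then show "red ` Rmod.span (v ` {..<e l}) = Lbar"
      using b(2) by (simp add: red_span image_image)
    show "dim_K (tensor_K (Rmod.span (v ` {..<e l})) \<inter> tensor_K (Ms i)) = e i" if "i \<le> l" for i
    proof -
      have "dim_K (tensor_K (Rmod.span (v ` {..<e l})) \<inter> tensor_K (Ms i)) =
          card {j. j < e l \<and> first_level e j \<le> i}"
        by (rule dim_tensor_K_span_inter[where l = l]) (use Ms mono lev v that in auto)
      also have "\<dots> = e i"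
        by (rule card_first_level_le[of l e, OF e_mono that])
      finally show ?thesis .
    qed
  qed
qed

theorem mainTheorem10:
  fixes Ms :: "nat \<Rightarrow> ('a::field fps ^ 'n) set"
    and h :: "nat \<Rightarrow> nat" and l :: nat
    and Lbar :: "('a ^ 'n) set"
    and d' :: "nat \<Rightarrow> int"
  assumes "Ms 0 = {0}" and "Ms l = UNIV"
    and "\<forall>i<l. Ms i \<subseteq> Ms (Suc i)"
    and "\<forall>i\<le>l. direct_summand (Ms i) \<and> free_of_rank (Ms i) (h i)"
    and "h 0 = 0"
    and "subspace_k Lbar"
    and "d' 0 = 0"
    and "d' l = int (dim_k (Lbar \<inter> red ` Ms l))"
    and "\<forall>i<l. 0 \<le> d' (Suc i) - d' i \<and> d' (Suc i) - d' i \<le> int (h (Suc i)) - int (h i)"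
    and "\<forall>i. 1 \<le> i \<and> i \<le> l - 1 \<longrightarrow> d' i \<le> int (dim_k (Lbar \<inter> red ` Ms i))"
  shows "\<exists>L. direct_summand L \<and> red ` L = Lbar \<and>
           (\<forall>i. 1 \<le> i \<and> i \<le> l \<longrightarrow>
              int (dim_K (tensor_K L \<inter> tensor_K (Ms i))) = d' i)"
proof -
  have ds: "direct_summand (Ms i)" and dim_red: "vec.dim (red ` Ms i) = h i" if "i \<le> l" for i
    using assms(4) that dim_red_free by blast+
  have d'_mono: "d' i \<le> d' (Suc i)" if "i < l" for i
    using assms(9) that by auto
  define e where "e i = nat (d' i)" for i
  have e: "int (e i) = d' i" if "i \<le> l" for i
    using lift_Suc_mono_le_bounded[of l d' 0 i, OF d'_mono] that assms(7) by (simp add: e_def)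
  have dim_k: "dim_k S = vec.dim S" for S :: "('a ^ 'n) set"
    by (simp add: dim_k_def scale_k_eq)
  obtain L where L: "direct_summand L" "red ` L = Lbar"
    "\<And>i. i \<le> l \<Longrightarrow> dim_K (tensor_K L \<inter> tensor_K (Ms i)) = e i"
  proof (rule exists_direct_summand_with_levels[of l Ms Lbar e])
    show "e l = vec.dim Lbar"
      using e[of l] assms(2,8) by (simp add: dim_k range_red)
    show "e i \<le> e (Suc i)" "e (Suc i) + vec.dim (red ` Ms i) \<le> vec.dim (red ` Ms (Suc i)) + e i"
      if "i < l" for i
      using assms(9) that e[of i] e[of "Suc i"] dim_red[of i] dim_red[of "Suc i"] by auto
    show "e i \<le> vec.dim (Lbar \<inter> red ` Ms i)" if "i \<le> l" for i
    proof -
      have "d' i \<le> int (vec.dim (Lbar \<inter> red ` Ms i))"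
        using assms(7,8,10) that by (cases "i = 0 \<or> i = l") (auto simp: dim_k)
      then show ?thesis
        using e[OF that] by simp
    qed
  qed (use ds assms(2,3,6,7) in \<open>auto simp: e_def subspace_k_def scale_k_eq\<close>)
  then show ?thesis
    using e by auto
qed

end
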